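(* Let $n\geq 1$ be an integer and let $\underline{\lambda}=(\lambda_1,\lambda_2,\lambda_3)\in\mathbb{C}^3$. For $X,Y,Z\in\mathbb{R}^{4n}$ let $$h_{\underline{\lambda}}(X,Y,Z)=\left|\langle Y,\Phi Z\rangle\right|^{\lambda_1}\left|\langle Z,\Phi X\rangle\right|^{\lambda_2}\left|\langle X,\Phi Y\rangle\right|^{\lambda_3}.$$ Then the integral $$\int_{S^{4n-1}\times S^{4n-1}\times S^{4n-1}}h_{\underline{\lambda}}(X,Y,Z)\,d\sigma(X)\,d\sigma(Y)\,d\sigma(Z)$$ converges absolutely if and only if $\mathrm{Re}(\lambda_j)>-1$ for every $j\in\{1,2,3\}$.
   Context: $S^{4n-1}$ is the unit sphere of $\mathbb{R}^{4n}$, $\sigma$ is its Euclidean surface measure and $\langle\cdot,\cdot\rangle$ is the standard scalar product on $\mathbb{R}^{4n}$. $J=\begin{pmatrix}0&-I_n\\ I_n&0\end{pmatrix}$ is of size $2n\times 2n$ and $\Phi=\begin{pmatrix}J&0\\0&-J\end{pmatrix}$ is of size $4n\times 4n$. Under the identification $\mathbb{C}^{2n}\simeq\mathbb{R}^{4n}$ given by $(X_1^1+iX_1^2,\,X_2^1+iX_2^2)\mapsto(X_1^1,X_2^1,X_1^2,X_2^2)$ with all $X_a^b\in\mathbb{R}^n$, one has $\langle X,\Phi Y\rangle=\mathrm{Re}\,\omega(X,Y)$, where $\omega(X,Y)=\sum_{k=1}^{2n}X_k(JY)_k$ is the standard complex symplectic form on $\mathbb{C}^{2n}$. *)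

theory Defs
  imports "HOL-Analysis.Analysis"
begin

text \<open>
  The Euclidean surface measure on the unit sphere of a Euclidean space of dimension \<open>d\<close>,
  obtained from Lebesgue measure by polar coordinates: the area of \<open>A\<close> is \<open>d\<close> times the
  volume of the part of the unit ball lying on the rays through \<open>A\<close>. (The factor \<open>d\<close> comes
  from integrating \<open>r ^ (d - 1)\<close> over \<open>0 < r < 1\<close>.) Recall \<open>sgn x = x /\<^sub>R norm x\<close>.
\<close>

definition sphere_measure :: "'a::euclidean_space measure" where
  "sphere_measure =
     scale_measure (of_nat DIM('a))
       (distr (restrict_space lborel (ball 0 1 - {0})) (restrict_space borel (sphere 0 1)) sgn)"

lemma space_sphere_measure: "space (sphere_measure :: 'a::euclidean_space measure) = sphere 0 1"
  by (simp add: sphere_measure_def space_scale_measure space_restrict_space)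

lemma sets_sphere_measure:
  "sets (sphere_measure :: 'a::euclidean_space measure) = sets (restrict_space borel (sphere 0 1))"
  by (simp add: sphere_measure_def)

lemma emeasure_sphere_measure:
  fixes A :: "'a::euclidean_space set"
  assumes "A \<in> sets (restrict_space borel (sphere 0 1))"
  shows "emeasure sphere_measure A =
           of_nat DIM('a) * emeasure lborel {r *\<^sub>R x |r x. 0 < r \<and> r < 1 \<and> x \<in> A}"
proof -
  have sub: "A \<subseteq> sphere 0 1"
    using sets.sets_into_space[OF assms] by (simp add: space_restrict_space)
  have "(\<lambda>x::'a. x /\<^sub>R norm x) \<in> borel_measurable borel"
    by measurable
  then have "(sgn :: 'a \<Rightarrow> 'a) \<in> borel_measurable (restrict_space lborel (ball 0 1 - {0}))"
    by (intro measurable_restrict_space1) (simp add: sgn_div_norm[abs_def])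
  then have meas: "(sgn :: 'a \<Rightarrow> 'a) \<in> restrict_space lborel (ball 0 1 - {0}) \<rightarrow>\<^sub>M restrict_space borel (sphere 0 1)"
    by (intro measurable_restrict_space2) (auto simp: space_restrict_space norm_sgn)
  have eq: "sgn -` A \<inter> (ball 0 1 - {0}) = {r *\<^sub>R x |r x. 0 < r \<and> r < 1 \<and> x \<in> A}"
  proof (intro set_eqI iffI)
    fix y assume y: "y \<in> sgn -` A \<inter> (ball 0 1 - {0})"
    then have "y = norm y *\<^sub>R sgn y" "0 < norm y" "norm y < 1" "sgn y \<in> A"
      by (auto simp: sgn_div_norm)
    then show "y \<in> {r *\<^sub>R x |r x. 0 < r \<and> r < 1 \<and> x \<in> A}" by blast
  next
    fix y assume "y \<in> {r *\<^sub>R x |r x. 0 < r \<and> r < 1 \<and> x \<in> A}"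
    then obtain r x where "y = r *\<^sub>R x" "0 < r" "r < 1" "x \<in> A" by blast
    moreover from this sub have "norm x = 1" by auto
    ultimately show "y \<in> sgn -` A \<inter> (ball 0 1 - {0})"
      by (auto simp: sgn_div_norm)
  qed
  have "emeasure (restrict_space lborel (ball 0 1 - {0})) (sgn -` A \<inter> (ball 0 1 - {0})) =
      emeasure lborel (sgn -` A \<inter> (ball (0::'a) 1 - {0}))"
    by (rule emeasure_restrict_space) auto
  then show ?thesis
    using assms
    by (simp add: sphere_measure_def emeasure_distr[OF meas] space_restrict_space eq)
qed

text \<open>
  Block matrices; the index type \<open>'a + 'b\<close> lists the \<open>'a\<close>-indices first. The dimension
  \<open>n \<ge> 1\<close> is the cardinality of the finite (hence nonempty) type \<open>'n\<close>, so that
  \<open>('n + 'n) + ('n + 'n)\<close> is the index type of vectors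
  \<open>(X\<^sub>1\<^sup>1, X\<^sub>2\<^sup>1, X\<^sub>1\<^sup>2, X\<^sub>2\<^sup>2)\<close> of \<open>4n\<close>-dimensional space.
\<close>

definition block_matrix ::
  "real^'c^'a \<Rightarrow> real^'d^'a \<Rightarrow> real^'c^'b \<Rightarrow> real^'d^'b \<Rightarrow>
   real^('c::finite + 'd::finite)^('a::finite + 'b::finite)" where
  "block_matrix A B C D =
     (\<chi> i j. case (i, j) of
        (Inl a, Inl c) \<Rightarrow> A $ a $ c
      | (Inl a, Inr d) \<Rightarrow> B $ a $ d
      | (Inr b, Inl c) \<Rightarrow> C $ b $ c
      | (Inr b, Inr d) \<Rightarrow> D $ b $ d)"

definition J_matrix :: "real^('n::finite + 'n)^('n + 'n)" where
  "J_matrix = block_matrix 0 (- mat 1) (mat 1) 0"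

definition Phi_matrix :: "real^(('n::finite + 'n) + ('n + 'n))^(('n + 'n) + ('n + 'n))" where
  "Phi_matrix = block_matrix J_matrix 0 0 (- J_matrix)"

text \<open>
  Note \<open>0 powr z = 0\<close> for every complex \<open>z\<close>; this convention only matters where one of the
  three pairings vanishes.
\<close>

definition h_kernel ::
  "complex^3 \<Rightarrow> real^(('n::finite + 'n) + ('n + 'n)) \<Rightarrow> real^(('n + 'n) + ('n + 'n)) \<Rightarrow>
   real^(('n + 'n) + ('n + 'n)) \<Rightarrow> complex" where
  "h_kernel lam X Y Z =
     complex_of_real \<bar>Y \<bullet> (Phi_matrix *v Z)\<bar> powr (lam $ 1) *
     complex_of_real \<bar>Z \<bullet> (Phi_matrix *v X)\<bar> powr (lam $ 2) *
     complex_of_real \<bar>X \<bullet> (Phi_matrix *v Y)\<bar> powr (lam $ 3)"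

end

theory Submission imports Defs begin

text \<open>
  Write \<open>\<omega> x y = x \<bullet> \<Phi> y\<close>; this is a symplectic form, and \<open>\<Phi>\<close> is an orthogonal complex structure.
  Since \<open>\<omega>\<close> is homogeneous, the integral over three spheres becomes an integral over three unit
  balls of the kernel evaluated at \<open>sgn x\<close>, \<open>sgn y\<close>, \<open>sgn z\<close>.

  Convergence. On the sphere \<open>\<bar>\<omega>\<bar> \<le> 1\<close>, so each of the three factors is at most
  \<open>\<bar>\<omega>\<bar> powr (- s)\<close> for a single \<open>s < 1\<close>. The three pairings all vanish, with linearly dependent
  differentials, where \<open>x\<close>, \<open>y\<close>, \<open>z\<close> are collinear, so the singularities are not normal crossings.
  This is handled by integrating one variable at a time and by averaging over
  translates: up to enlarging the ball, the integral of \<open>f\<close> is at most the integral of the averages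
  of \<open>f\<close> along segments in a direction \<open>w\<close>. If \<open>f z = g z * \<bar>l z\<bar> powr (- s)\<close> with \<open>l\<close> linear and \<open>g\<close>
  constant along \<open>w\<close>, then such an average costs a factor \<open>\<bar>l w\<bar> powr (- s)\<close> and removes \<open>l\<close>
  (\<open>nn_integral_ball_singular_linear\<close>). Fix a unit vector \<open>x\<close> and choose a unit vector \<open>w\<close>
  orthogonal to \<open>x\<close> and \<open>\<Phi> x\<close>. In the integral over \<open>z\<close>, averaging along \<open>w\<close> and then along \<open>\<Phi> x\<close>
  replaces \<open>\<bar>\<omega> y z\<bar> powr (- s) * \<bar>\<omega> z x\<bar> powr (- s)\<close> by \<open>\<bar>\<omega> y w\<bar> powr (- s)\<close>. In the remaining integral
  over \<open>y\<close> of \<open>\<bar>\<omega> y w\<bar> powr (- s) * \<bar>\<omega> x y\<bar> powr (- s)\<close> the two linear forms are orthogonal, and averaging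
  along \<open>\<Phi> w\<close> and \<open>\<Phi> x\<close> bounds it. All bounds are uniform in \<open>x\<close>
  (\<open>kernel_integral_finite\<close>).

  Divergence. A cyclic permutation of the variables moves any of the exponents to the first
  place, so let \<open>a \<le> -1\<close> be the exponent of \<open>\<bar>\<omega> y z\<bar>\<close>. For fixed \<open>x\<close>, \<open>y\<close> with \<open>\<omega> x y \<noteq> 0\<close> the point
  \<open>z = y\<close> lies on the hyperplane \<open>\<omega> y z = 0\<close>, while the other two factors are positive and continuous
  there. Near this point the integral over \<open>z\<close> is that of \<open>\<bar>l z\<bar> powr a\<close> for a nonzero linear form
  \<open>l\<close>, which is infinite (\<open>kernel_slice_divergent\<close>). This happens for an open set of \<open>y\<close>, whatever
  \<open>x\<close> is (\<open>kernel_integral_infinite\<close>).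
\<close>

section \<open>Averaging over translates along a direction\<close>


text \<open>
  By translation invariance every translate of \<open>g\<close> has the same integral. Both directions of
  the main result use this in place of coordinates adapted to \<open>w\<close>: the inner integral on the left
  only sees \<open>g\<close> on a line parallel to \<open>w\<close>.
\<close>

lemma nn_integral_translates:
  fixes w :: "'a::euclidean_space" and g :: "'a \<Rightarrow> ennreal"
  assumes [measurable]: "g \<in> borel_measurable borel" "I \<in> sets borel"
  shows "(\<integral>\<^sup>+z. (\<integral>\<^sup>+r\<in>I. g (z + r *\<^sub>R w) \<partial>lborel) \<partial>lborel)
         = emeasure lborel I * (\<integral>\<^sup>+z. g z \<partial>lborel)"
proof -
  have shift: "(\<integral>\<^sup>+z. g (z + c) \<partial>lborel) = (\<integral>\<^sup>+z. g z \<partial>lborel)" for c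
    by (subst lborel_distr_plus[of c, symmetric], subst nn_integral_distr)
       (simp_all add: add.commute)
  have "(\<integral>\<^sup>+z. (\<integral>\<^sup>+r\<in>I. g (z + r *\<^sub>R w) \<partial>lborel) \<partial>lborel)
      = (\<integral>\<^sup>+r. (\<integral>\<^sup>+z. g (z + r *\<^sub>R w) * indicator I r \<partial>lborel) \<partial>lborel)"
    by (rule lborel_pair.Fubini') measurable
  also have "\<dots> = (\<integral>\<^sup>+r. (\<integral>\<^sup>+z. g z \<partial>lborel) * indicator I r \<partial>lborel)"
    by (intro nn_integral_cong) (simp add: nn_integral_multc shift)
  also have "\<dots> = emeasure lborel I * (\<integral>\<^sup>+z. g z \<partial>lborel)"
    by (subst nn_integral_cmult_indicator) (simp_all add: mult.commute)
  finally show ?thesis .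
qed

lemma emeasure_lborel_open_nonzero:
  fixes U :: "'a::euclidean_space set"
  shows "open U \<Longrightarrow> U \<noteq> {} \<Longrightarrow> emeasure lborel U \<noteq> 0"
  using open_not_negligible[of U] by (auto simp: negligible_iff_null_sets null_sets_def)

text \<open>
  The value at \<open>0\<close> is \<open>\<infinity>\<close> and not \<open>0 powr (- s) = 0\<close>. With this choice \<open>singular_power s\<close> is
  multiplicative, and upper bounds of the form \<open>C * singular_power s (l w)\<close> remain true, though
  trivial, for \<open>l w = 0\<close>.
\<close>

definition singular_power :: "real \<Rightarrow> real \<Rightarrow> ennreal" where
  "singular_power s t = inverse (ennreal (\<bar>t\<bar> powr s))"

lemma borel_measurable_singular_power [measurable]:
  "singular_power s \<in> borel_measurable borel"
  unfolding singular_power_def[abs_def] by measurable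

lemma singular_power_eq: "t \<noteq> 0 \<Longrightarrow> singular_power s t = ennreal (\<bar>t\<bar> powr (- s))"
  by (simp add: singular_power_def inverse_ennreal powr_minus)

lemma singular_power_0: "singular_power s 0 = \<infinity>"
  by (simp add: singular_power_def)

lemma singular_power_minus: "singular_power s (- t) = singular_power s t"
  by (simp add: singular_power_def)

lemma singular_power_unit: "\<bar>t\<bar> = 1 \<Longrightarrow> singular_power s t = 1"
  by (simp add: singular_power_def)

lemma singular_power_mult: "singular_power s (t * u) = singular_power s t * singular_power s u"
  by (simp add: singular_power_def abs_mult powr_mult ennreal_mult ennreal_inverse_mult)

text \<open>
  Numbers of absolute value at most \<open>1\<close> have larger powers for smaller exponents. The passage
  from \<open>u\<close> to the smaller \<open>t\<close> later replaces \<open>\<omega> (sgn y) (sgn z)\<close> by \<open>\<omega> y z\<close>, which is linear in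
  each variable.
\<close>

lemma powr_le_singular_power:
  assumes "\<bar>t\<bar> \<le> \<bar>u\<bar>" "\<bar>u\<bar> \<le> 1" "0 \<le> s" "- s \<le> a"
  shows "ennreal (\<bar>u\<bar> powr a) \<le> singular_power s t"
proof (cases "t = 0")
  case True
  then show ?thesis by (simp add: singular_power_0)
next
  case False
  have "\<bar>u\<bar> powr a \<le> \<bar>u\<bar> powr (- s)"
    using assms False by (intro powr_mono') auto
  also have "\<dots> \<le> \<bar>t\<bar> powr (- s)"
    using assms False by (intro powr_mono2') auto
  finally show ?thesis
    using False by (simp add: singular_power_eq ennreal_leI)
qed

lemma nn_integral_singular_power_finite:
  assumes "s < 1"
  shows "(\<integral>\<^sup>+u\<in>{-1..1}. singular_power s u \<partial>lborel) < \<infinity>"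
proof -
  have pos: "(\<integral>\<^sup>+u\<in>{0..1}. singular_power s u \<partial>lborel) = ennreal (1 / (1 - s))"
  proof -
    have "(\<integral>\<^sup>+u\<in>{0..1}. singular_power s u \<partial>lborel)
        = (\<integral>\<^sup>+u. ennreal (u powr (- s)) * indicator {0..1} u \<partial>lborel)"
    proof (rule nn_integral_cong_AE)
      show "AE u in lborel. singular_power s u * indicator {0..1} u
          = ennreal (u powr (- s)) * indicator {0..1} u"
        using AE_lborel_singleton[of "0::real"]
        by eventually_elim (auto simp: singular_power_eq indicator_def)
    qed
    also have "\<dots> = ennreal (1 powr (- s + 1) / (- s + 1))"
      using assms
      by (intro nn_integral_has_integral_lebesgue' has_integral_powr_from_0) auto
    finally show ?thesis by (simp add: add.commute)
  qed
  have neg: "(\<integral>\<^sup>+u\<in>{-1..0}. singular_power s u \<partial>lborel)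
      = (\<integral>\<^sup>+u\<in>{0..1}. singular_power s u \<partial>lborel)"
    by (subst nn_integral_real_affine[where c="-1" and t=0])
       (auto intro!: nn_integral_cong simp: singular_power_minus indicator_def)
  have "(\<integral>\<^sup>+u\<in>{-1..1}. singular_power s u \<partial>lborel)
      \<le> (\<integral>\<^sup>+u. singular_power s u * indicator {-1..0} u + singular_power s u * indicator {0..1} u \<partial>lborel)"
    by (intro nn_integral_mono) (auto simp: indicator_def)
  also have "\<dots> = ennreal (1 / (1 - s)) + ennreal (1 / (1 - s))"
    by (simp add: nn_integral_add pos neg)
  also have "\<dots> < \<infinity>" by simp
  finally show ?thesis .
qed

text \<open>
  Scaling reduces the claim to \<open>b = 1\<close>. On the part of the segment where \<open>\<bar>c + r\<bar> > 1\<close> the integrand is at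
  most \<open>1\<close>, and the rest contributes at most the integral over \<open>{-1..1}\<close>, wherever the
  singularity \<open>r = - c\<close> lies. The uniformity in \<open>a\<close> is the point.
\<close>

lemma nn_integral_singular_power_line:
  assumes "0 \<le> s" "s < 1"
  obtains C where "C < \<infinity>"
    "\<And>a b. (\<integral>\<^sup>+r\<in>{0..1}. singular_power s (a + r * b) \<partial>lborel) \<le> C * singular_power s b"
proof -
  define K where "K = (\<integral>\<^sup>+u\<in>{-1..1}. singular_power s u \<partial>lborel)"
  have shifted: "(\<integral>\<^sup>+r\<in>{0..1}. singular_power s (c + r) \<partial>lborel) \<le> 1 + K" for c
  proof -
    have "(\<integral>\<^sup>+r\<in>{0..1}. singular_power s (c + r) \<partial>lborel)
        \<le> (\<integral>\<^sup>+r. indicator {0..1} r + singular_power s (c + r) * indicator {-1..1} (c + r) \<partial>lborel)"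
    proof (intro nn_integral_mono)
      fix r :: real
      have "singular_power s (c + r) \<le> 1" if "c + r \<notin> {-1..1}"
      proof -
        have "\<bar>c + r\<bar> powr (- s) \<le> 1 powr (- s)"
          using that assms by (intro powr_mono2') auto
        with that show ?thesis by (subst singular_power_eq) auto
      qed
      then show "singular_power s (c + r) * indicator {0..1} r
          \<le> indicator {0..1} r + singular_power s (c + r) * indicator {-1..1} (c + r)"
        by (auto simp: indicator_def)
    qed
    also have "\<dots> = 1 + (\<integral>\<^sup>+r. singular_power s (c + r) * indicator {-1..1} (c + r) \<partial>lborel)"
      by (subst nn_integral_add) auto
    also have "(\<integral>\<^sup>+r. singular_power s (c + r) * indicator {-1..1} (c + r) \<partial>lborel) = K"
      unfolding K_def by (subst (2) nn_integral_real_affine[where c=1 and t=c]) simp_all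
    finally show ?thesis .
  qed
  show thesis
  proof
    show "1 + K < \<infinity>"
      using nn_integral_singular_power_finite[OF \<open>s < 1\<close>] by (simp add: K_def)
    fix a b :: real
    show "(\<integral>\<^sup>+r\<in>{0..1}. singular_power s (a + r * b) \<partial>lborel) \<le> (1 + K) * singular_power s b"
    proof (cases "b = 0")
      case True
      then show ?thesis
        by (simp add: singular_power_0 ennreal_mult_top)
    next
      case False
      have factor: "singular_power s (a + r * b) = singular_power s b * singular_power s (a / b + r)" for r
      proof -
        have "a + r * b = b * (a / b + r)" using False by (simp add: field_simps)
        then show ?thesis by (simp only: singular_power_mult)
      qed
      have "(\<integral>\<^sup>+r\<in>{0..1}. singular_power s (a + r * b) \<partial>lborel)
          = (\<integral>\<^sup>+r. singular_power s b * (singular_power s (a / b + r) * indicator {0..1} r) \<partial>lborel)"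
        by (simp add: factor mult.assoc)
      also have "\<dots> \<le> singular_power s b * (1 + K)"
        by (subst nn_integral_cmult) (auto intro!: mult_left_mono shifted)
      finally show ?thesis by (simp add: mult.commute)
    qed
  qed
qed

lemma linear_imp_borel_measurable:
  fixes l :: "'a::euclidean_space \<Rightarrow> 'b::real_normed_vector"
  shows "linear l \<Longrightarrow> l \<in> borel_measurable borel"
  by (intro borel_measurable_continuous_onI linear_continuous_on linear_conv_bounded_linear[THEN iffD1])

text \<open>
  One step of the elimination of singular factors. Averaging over the segments \<open>z + r *\<^sub>R w\<close> with
  \<open>r \<in> {0..1}\<close> does not change \<open>g\<close>, while \<open>l (z + r *\<^sub>R w) = l z + r * l w\<close> runs along a real
  segment, where \<open>C\<close> bounds the integral uniformly in \<open>l z\<close>. The radius grows by \<open>1\<close> because the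
  segments leave the ball.
\<close>

lemma nn_integral_ball_singular_linear:
  fixes l :: "'a::euclidean_space \<Rightarrow> real" and g :: "'a \<Rightarrow> ennreal"
  assumes C: "\<And>a b. (\<integral>\<^sup>+r\<in>{0..1}. singular_power s (a + r * b) \<partial>lborel) \<le> C * singular_power s b"
    and l: "linear l" and [measurable]: "g \<in> borel_measurable borel"
    and w: "norm w \<le> 1" and inv: "\<And>z r. g (z + r *\<^sub>R w) = g z"
  shows "(\<integral>\<^sup>+z\<in>ball 0 R. g z * singular_power s (l z) \<partial>lborel)
         \<le> C * singular_power s (l w) * (\<integral>\<^sup>+z\<in>ball 0 (R + 1). g z \<partial>lborel)"
proof -
  note [measurable] = linear_imp_borel_measurable[OF l]
  have [measurable]: "ball (0::'a) r \<in> sets borel" for r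
    by simp
  let ?f = "\<lambda>z. g z * singular_power s (l z) * indicator (ball 0 R) z"
  have "(\<integral>\<^sup>+z. ?f z \<partial>lborel) = emeasure lborel {0..1::real} * (\<integral>\<^sup>+z. ?f z \<partial>lborel)"
    by simp
  also have "\<dots> = (\<integral>\<^sup>+z. (\<integral>\<^sup>+r\<in>{0..1}. ?f (z + r *\<^sub>R w) \<partial>lborel) \<partial>lborel)"
    by (rule nn_integral_translates[symmetric]) measurable
  also have "\<dots> \<le> (\<integral>\<^sup>+z. (C * singular_power s (l w)) * (g z * indicator (ball 0 (R + 1)) z) \<partial>lborel)"
  proof (intro nn_integral_mono)
    fix z :: 'a
    have "(\<integral>\<^sup>+r\<in>{0..1}. ?f (z + r *\<^sub>R w) \<partial>lborel)
        \<le> (\<integral>\<^sup>+r. (g z * indicator (ball 0 (R + 1)) z) * (singular_power s (l z + r * l w) * indicator {0..1} r) \<partial>lborel)"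
    proof (intro nn_integral_mono)
      fix r :: real
      have "z \<in> ball 0 (R + 1)" if "z + r *\<^sub>R w \<in> ball 0 R" "r \<in> {0..1}"
      proof -
        have "norm z \<le> norm (z + r *\<^sub>R w) + norm (r *\<^sub>R w)"
          by (metis add_diff_cancel_right' norm_triangle_ineq4)
        moreover have "norm (r *\<^sub>R w) \<le> 1"
          using that w by (simp add: mult_le_one)
        ultimately show ?thesis using that by simp
      qed
      then show "?f (z + r *\<^sub>R w) * indicator {0..1} r
          \<le> (g z * indicator (ball 0 (R + 1)) z) * (singular_power s (l z + r * l w) * indicator {0..1} r)"
        by (auto simp: indicator_def inv linear_add[OF l] linear_scale[OF l])
    qed
    also have "\<dots> \<le> (g z * indicator (ball 0 (R + 1)) z) * (C * singular_power s (l w))"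
      by (subst nn_integral_cmult) (auto intro!: mult_left_mono C)
    finally show "(\<integral>\<^sup>+r\<in>{0..1}. ?f (z + r *\<^sub>R w) \<partial>lborel)
        \<le> (C * singular_power s (l w)) * (g z * indicator (ball 0 (R + 1)) z)"
      by (simp add: mult.commute)
  qed
  also have "\<dots> = C * singular_power s (l w) * (\<integral>\<^sup>+z\<in>ball 0 (R + 1). g z \<partial>lborel)"
    by (rule nn_integral_cmult) measurable
  finally show ?thesis .
qed

text \<open>
  The direction \<open>w1\<close> leaves the second factor unchanged, so it removes the first one; then \<open>w2\<close>
  removes the second.
\<close>

lemma nn_integral_ball_two_singular_linear:
  fixes l1 l2 :: "'a::euclidean_space \<Rightarrow> real"
  assumes C: "\<And>a b. (\<integral>\<^sup>+r\<in>{0..1}. singular_power s (a + r * b) \<partial>lborel) \<le> C * singular_power s b"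
    and l1: "linear l1" and l2: "linear l2"
    and w1: "norm w1 \<le> 1" and w2: "norm w2 \<le> 1" and "l2 w1 = 0"
  shows "(\<integral>\<^sup>+z\<in>ball 0 1. singular_power s (l1 z) * singular_power s (l2 z) \<partial>lborel)
         \<le> C\<^sup>2 * emeasure lborel (ball (0::'a) 3) * singular_power s (l1 w1) * singular_power s (l2 w2)"
proof -
  note [measurable] = linear_imp_borel_measurable[OF l1] linear_imp_borel_measurable[OF l2]
  have "(\<integral>\<^sup>+z\<in>ball 0 1. singular_power s (l2 z) * singular_power s (l1 z) \<partial>lborel)
      \<le> C * singular_power s (l1 w1) * (\<integral>\<^sup>+z\<in>ball 0 (1 + 1). singular_power s (l2 z) \<partial>lborel)"
    using \<open>l2 w1 = 0\<close>
    by (intro nn_integral_ball_singular_linear C l1 w1)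
       (auto simp: linear_add[OF l2] linear_scale[OF l2])
  also have "\<dots> \<le> C * singular_power s (l1 w1) *
      (C * singular_power s (l2 w2) * emeasure lborel (ball (0::'a) 3))"
    using nn_integral_ball_singular_linear[OF C l2 _ w2, of "\<lambda>_. 1" 2]
    by - (rule mult_left_mono, simp_all)
  finally show ?thesis
    by (simp only: mult_ac power2_eq_square)
qed

text \<open>
  The hypothesis on \<open>t\<close> puts the singularity \<open>r = - t\<close> in the interior of the interval. To its right
  the integrand dominates \<open>1 / (t + r)\<close>.
\<close>

lemma nn_integral_powr_divergent:
  assumes "a \<le> -1" "\<bar>t\<bar> < \<delta>"
  shows "(\<integral>\<^sup>+r\<in>{-\<delta>..\<delta>}. ennreal (\<bar>t + r\<bar> powr a) \<partial>lborel) = \<infinity>"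
proof -
  define \<eta> where "\<eta> = min 1 (\<delta> - \<bar>t\<bar>)"
  have \<eta>: "0 < \<eta>" "\<eta> \<le> 1" "\<eta> \<le> \<delta> - \<bar>t\<bar>" using assms by (auto simp: \<eta>_def)
  have "ennreal (real n) \<le> (\<integral>\<^sup>+r\<in>{-\<delta>..\<delta>}. ennreal (\<bar>t + r\<bar> powr a) \<partial>lborel)" for n
  proof -
    \<comment> \<open>This \<open>e\<close> makes the integral of \<open>1 / u\<close> over \<open>{e..\<eta>}\<close> equal to \<open>n\<close>.\<close>
    define e where "e = \<eta> * exp (- real n)"
    have e: "0 < e" "e \<le> \<eta>" using \<eta> by (auto simp: e_def mult_le_cancel_left1)
    have "(\<integral>\<^sup>+u. ennreal (1 / u) * indicator {e..\<eta>} u \<partial>lborel) = ennreal (ln \<eta> - ln e)"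
      using e by (intro nn_integral_FTC_Icc) (auto intro!: derivative_eq_intros simp: has_real_derivative_iff_has_vector_derivative[symmetric] divide_simps)
    also have "ln \<eta> - ln e = real n"
      using \<eta> by (simp add: e_def ln_mult)
    finally have "ennreal (real n) = (\<integral>\<^sup>+u. ennreal (1 / u) * indicator {e..\<eta>} u \<partial>lborel)" ..
    also have "\<dots> = (\<integral>\<^sup>+r. ennreal (1 / (t + r)) * indicator {e..\<eta>} (t + r) \<partial>lborel)"
      by (subst nn_integral_real_affine[where c=1 and t=t]) simp_all
    also have "\<dots> \<le> (\<integral>\<^sup>+r\<in>{-\<delta>..\<delta>}. ennreal (\<bar>t + r\<bar> powr a) \<partial>lborel)"
    proof (intro nn_integral_mono)
      fix r :: real
      have "1 / (t + r) \<le> \<bar>t + r\<bar> powr a \<and> r \<in> {-\<delta>..\<delta>}" if "t + r \<in> {e..\<eta>}"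
      proof -
        have "(t + r) powr (-1) \<le> (t + r) powr a"
          using that e \<eta> assms by (intro powr_mono') auto
        then show ?thesis using that e \<eta> by (auto simp: powr_minus_divide)
      qed
      then show "ennreal (1 / (t + r)) * indicator {e..\<eta>} (t + r)
          \<le> ennreal (\<bar>t + r\<bar> powr a) * indicator {-\<delta>..\<delta>} r"
        by (auto simp: indicator_def intro!: ennreal_leI)
    qed
    finally show ?thesis .
  qed
  then show ?thesis
    by (metis ennreal_Ex_less_of_nat ennreal_of_nat_eq_real_of_nat infinity_ennreal_def
        leD top.not_eq_extremum)
qed

text \<open>
  The averaging argument read backwards: along every segment in a direction transverse to the
  hyperplane \<open>l z = 0\<close> that starts near \<open>p\<close>, the one-dimensional integral already diverges.
\<close>

lemma nn_integral_ball_powr_linear_divergent: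
  fixes l :: "'a::euclidean_space \<Rightarrow> real"
  assumes l: "linear l" and "l w \<noteq> 0" "l p = 0" "\<epsilon> > 0" "a \<le> -1"
  shows "(\<integral>\<^sup>+z\<in>ball p \<epsilon>. ennreal (\<bar>l z\<bar> powr a) \<partial>lborel) = \<infinity>"
proof -
  note [measurable] = linear_imp_borel_measurable[OF l]
  define v where "v = w /\<^sub>R l w"
  have lv: "l v = 1" using assms by (simp add: v_def linear_scale[OF l])
  have v0: "norm v > 0" using lv linear_0[OF l] by force
  define \<delta> where "\<delta> = \<epsilon> / (2 * norm v)"
  have \<delta>: "\<delta> > 0" "\<delta> * norm v = \<epsilon> / 2" using assms v0 by (auto simp: \<delta>_def)
  obtain \<eta> where \<eta>: "\<eta> > 0" "\<eta> \<le> \<epsilon> / 2" "\<And>z. z \<in> ball p \<eta> \<Longrightarrow> \<bar>l z\<bar> < \<delta>"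
  proof -
    have "isCont l p" using l by (simp add: linear_continuous_at linear_conv_bounded_linear)
    then obtain d where "d > 0" "\<And>z. dist z p < d \<Longrightarrow> dist (l z) (l p) < \<delta>"
      using \<delta> unfolding continuous_at_eps_delta by (metis)
    then show thesis
      using assms by (intro that[of "min d (\<epsilon> / 2)"]) (auto simp: dist_commute)
  qed
  let ?f = "\<lambda>z. ennreal (\<bar>l z\<bar> powr a) * indicator (ball p \<epsilon>) z"
  have "\<infinity> = \<infinity> * emeasure lborel (ball p \<eta>)"
    using \<eta> by (simp add: ennreal_top_mult emeasure_lborel_open_nonzero)
  also have "\<dots> = (\<integral>\<^sup>+z\<in>ball p \<eta>. \<infinity> \<partial>lborel)"
    by (simp add: nn_integral_cmult_indicator)
  also have "\<dots> \<le> (\<integral>\<^sup>+z. (\<integral>\<^sup>+r\<in>{-\<delta>..\<delta>}. ?f (z + r *\<^sub>R v) \<partial>lborel) \<partial>lborel)"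
  proof (intro nn_integral_mono)
    fix z :: 'a
    have "(\<integral>\<^sup>+r\<in>{-\<delta>..\<delta>}. ?f (z + r *\<^sub>R v) \<partial>lborel) = \<infinity>" if z: "z \<in> ball p \<eta>"
    proof -
      have "z + r *\<^sub>R v \<in> ball p \<epsilon>" if "r \<in> {-\<delta>..\<delta>}" for r
      proof -
        have "norm (r *\<^sub>R v) \<le> \<epsilon> / 2"
          using that mult_right_mono[of "\<bar>r\<bar>" \<delta> "norm v"] \<delta> by auto
        moreover have "dist p (z + r *\<^sub>R v) \<le> dist p z + norm (r *\<^sub>R v)"
          by (metis add_diff_cancel_left' dist_commute dist_norm dist_triangle)
        ultimately show ?thesis using z \<eta> by simp
      qed
      then have "(\<integral>\<^sup>+r\<in>{-\<delta>..\<delta>}. ?f (z + r *\<^sub>R v) \<partial>lborel)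
          = (\<integral>\<^sup>+r\<in>{-\<delta>..\<delta>}. ennreal (\<bar>l z + r\<bar> powr a) \<partial>lborel)"
        by (intro nn_integral_cong) (auto simp: indicator_def linear_add[OF l] linear_scale[OF l] lv)
      also have "\<dots> = \<infinity>"
        using z assms \<eta> by (intro nn_integral_powr_divergent) auto
      finally show ?thesis .
    qed
    then show "\<infinity> * indicator (ball p \<eta>) z \<le> (\<integral>\<^sup>+r\<in>{-\<delta>..\<delta>}. ?f (z + r *\<^sub>R v) \<partial>lborel)"
      by (auto simp: indicator_def)
  qed
  also have "\<dots> = emeasure lborel {-\<delta>..\<delta>} * (\<integral>\<^sup>+z. ?f z \<partial>lborel)"
    by (rule nn_integral_translates) (measurable, simp_all)
  finally show ?thesis
    using \<delta> by (auto simp: top_unique ennreal_mult_eq_top_iff)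
qed

section \<open>The surface measure as an integral over the ball\<close>


text \<open>
  The surface measure is, up to the factor \<open>DIM('a)\<close>, the image of this measure under \<open>sgn\<close>.
  A density is used rather than a restriction because its measurable sets are all Borel sets, so
  that iterated integrals of globally defined Borel functions cause no measurability questions.
\<close>

definition ball_measure :: "'a::euclidean_space measure" where
  "ball_measure = density lborel (indicator (ball 0 1 - {0}))"

lemma punctured_ball_borel [measurable]: "ball 0 1 - {0 :: 'a::euclidean_space} \<in> sets borel"
  by auto

lemma sets_ball_measure [measurable_cong, simp]: "sets ball_measure = sets borel"
  by (simp add: ball_measure_def)

lemma nn_integral_ball_measure:
  assumes [measurable]: "f \<in> borel_measurable borel"
  shows "(\<integral>\<^sup>+z. f z \<partial>ball_measure) = (\<integral>\<^sup>+z\<in>ball 0 1 - {0}. f z \<partial>lborel)"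
  unfolding ball_measure_def
  by (subst nn_integral_density) (simp_all add: mult.commute)

lemma AE_ball_measure: "AE z in ball_measure. z \<in> ball 0 1 - {0}"
  unfolding ball_measure_def by (subst AE_density) (auto simp: indicator_def)

lemma nn_integral_const_ball_measure:
  "(\<integral>\<^sup>+(z::'a::euclidean_space). c \<partial>ball_measure) = c * emeasure lborel (ball 0 1 - {0::'a})"
  by (subst nn_integral_ball_measure) (auto simp: nn_integral_cmult_indicator)

lemma emeasure_punctured_ball_finite:
  "emeasure lborel (ball 0 1 - {0 :: 'a::euclidean_space}) < \<infinity>"
  by (rule order_le_less_trans[OF emeasure_mono emeasure_lborel_ball_finite[of 0 1]]) auto

interpretation ball_measure: finite_measure "ball_measure :: 'a::euclidean_space measure"
  using nn_integral_const_ball_measure[of 1, where 'a='a] emeasure_punctured_ball_finite[where 'a='a]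
  by (intro finite_measureI) (simp add: less_top)

interpretation ball_measure_pair: pair_sigma_finite
  "ball_measure :: 'a::euclidean_space measure" "ball_measure :: 'b::euclidean_space measure" ..

lemma sgn_borel_measurable [measurable]: "(sgn :: 'a::euclidean_space \<Rightarrow> 'a) \<in> borel_measurable borel"
  unfolding sgn_div_norm[abs_def] by measurable

lemma measurable_id_sphere_measure: "(\<lambda>x. x) \<in> measurable sphere_measure borel"
  by (simp add: measurable_cong_sets[OF sets_sphere_measure refl] measurable_restrict_space1)

lemma nn_integral_sphere_measure:
  fixes f :: "'a::euclidean_space \<Rightarrow> ennreal"
  assumes f [measurable]: "f \<in> borel_measurable borel"
  shows "(\<integral>\<^sup>+x. f x \<partial>sphere_measure) = of_nat DIM('a) * (\<integral>\<^sup>+z. f (sgn z) \<partial>ball_measure)"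
proof -
  let ?R = "restrict_space lborel (ball 0 1 - {0::'a})"
  have sgn: "sgn \<in> ?R \<rightarrow>\<^sub>M restrict_space borel (sphere 0 1)"
    by (intro measurable_restrict_space2 measurable_restrict_space1)
       (auto simp: space_restrict_space norm_sgn)
  have "f \<in> borel_measurable (restrict_space borel (sphere 0 1))"
    by (intro measurable_restrict_space1) simp
  then have "(\<integral>\<^sup>+x. f x \<partial>sphere_measure) = of_nat DIM('a) * (\<integral>\<^sup>+z. f (sgn z) \<partial>?R)"
    by (simp add: sphere_measure_def nn_integral_scale_measure nn_integral_distr[OF sgn])
  then show ?thesis
    by (simp add: nn_integral_restrict_space nn_integral_ball_measure)
qed

interpretation sphere_measure: finite_measure "sphere_measure :: 'a::euclidean_space measure"
  using nn_integral_sphere_measure[of "\<lambda>_::'a. 1"]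
    nn_integral_const_ball_measure[of 1, where 'a='a] emeasure_punctured_ball_finite[where 'a='a]
  by (intro finite_measureI) (simp add: less_top ennreal_mult_eq_top_iff)

interpretation sphere_measure_pair: pair_sigma_finite
  "sphere_measure :: 'a::euclidean_space measure" "sphere_measure :: 'b::euclidean_space measure" ..

text \<open>
  The sphere carries the trace of the Borel sets, so measurability is obtained by composing with
  the inclusion in each of the three variables.
\<close>

lemma measurable_triple_sphere_measure:
  assumes "F \<in> measurable (borel \<Otimes>\<^sub>M (borel \<Otimes>\<^sub>M borel)) N"
  shows "F \<in> measurable (sphere_measure \<Otimes>\<^sub>M (sphere_measure \<Otimes>\<^sub>M sphere_measure)) N"
proof -
  note * = measurable_compose[OF _ measurable_id_sphere_measure]
  have "(\<lambda>p. (fst p, fst (snd p), snd (snd p)))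
      \<in> sphere_measure \<Otimes>\<^sub>M (sphere_measure \<Otimes>\<^sub>M sphere_measure) \<rightarrow>\<^sub>M borel \<Otimes>\<^sub>M (borel \<Otimes>\<^sub>M borel)"
    by (intro measurable_Pair *[OF measurable_fst] measurable_compose[OF measurable_snd]
          *[OF measurable_snd])
  from measurable_compose[OF this assms] show ?thesis by simp
qed

lemma nn_integral_triple_sphere_measure:
  fixes F :: "'a::euclidean_space \<times> 'a \<times> 'a \<Rightarrow> ennreal"
  assumes F [measurable]: "F \<in> borel_measurable (borel \<Otimes>\<^sub>M (borel \<Otimes>\<^sub>M borel))"
  shows "(\<integral>\<^sup>+p. F p \<partial>(sphere_measure \<Otimes>\<^sub>M (sphere_measure \<Otimes>\<^sub>M sphere_measure)))
    = of_nat DIM('a) ^ 3 * (\<integral>\<^sup>+x. (\<integral>\<^sup>+y. (\<integral>\<^sup>+z. F (sgn x, sgn y, sgn z)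
        \<partial>ball_measure) \<partial>ball_measure) \<partial>ball_measure)"
proof -
  let ?D = "of_nat DIM('a) :: ennreal"
  let ?S = "sphere_measure :: 'a measure"
  note FS = measurable_triple_sphere_measure[OF F]
  have prod: "sigma_finite_measure (?S \<Otimes>\<^sub>M ?S)"
    by (rule sigma_finite_pair_measure) unfold_locales
  have "(\<integral>\<^sup>+p. F p \<partial>(?S \<Otimes>\<^sub>M (?S \<Otimes>\<^sub>M ?S)))
      = (\<integral>\<^sup>+x. (\<integral>\<^sup>+q. F (x, q) \<partial>(?S \<Otimes>\<^sub>M ?S)) \<partial>?S)"
    by (rule sigma_finite_measure.nn_integral_fst[OF prod FS, symmetric])
  also have "\<dots> = (\<integral>\<^sup>+x. (\<integral>\<^sup>+y. (\<integral>\<^sup>+z. F (x, y, z) \<partial>?S) \<partial>?S) \<partial>?S)"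
    by (intro nn_integral_cong sphere_measure.nn_integral_fst[symmetric]
          measurable_compose[OF measurable_Pair1' FS])
  also have "\<dots> = (\<integral>\<^sup>+x. (\<integral>\<^sup>+y. ?D * (\<integral>\<^sup>+z. F (x, y, sgn z) \<partial>ball_measure) \<partial>?S) \<partial>?S)"
    by (intro nn_integral_cong nn_integral_sphere_measure) measurable
  also have "\<dots> = (\<integral>\<^sup>+x. ?D * (\<integral>\<^sup>+y. ?D * (\<integral>\<^sup>+z. F (x, sgn y, sgn z) \<partial>ball_measure) \<partial>ball_measure) \<partial>?S)"
    by (intro nn_integral_cong nn_integral_sphere_measure) measurable
  also have "\<dots> = ?D * (\<integral>\<^sup>+x. ?D * (\<integral>\<^sup>+y. ?D * (\<integral>\<^sup>+z. F (sgn x, sgn y, sgn z)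
      \<partial>ball_measure) \<partial>ball_measure) \<partial>ball_measure)"
    by (intro nn_integral_sphere_measure) measurable
  also have "\<dots> = ?D ^ 3 * (\<integral>\<^sup>+x. (\<integral>\<^sup>+y. (\<integral>\<^sup>+z. F (sgn x, sgn y, sgn z)
        \<partial>ball_measure) \<partial>ball_measure) \<partial>ball_measure)"
    by (simp add: nn_integral_cmult power3_eq_cube mult.assoc)
  finally show ?thesis .
qed

section \<open>The symplectic form of an orthogonal complex structure\<close>

text \<open>
  These are the only properties of the matrix \<open>\<Phi>\<close> that matter. The condition on the dimension
  provides a vector orthogonal to both \<open>x\<close> and \<open>\<Phi> x\<close>. In dimension \<open>2\<close> the three pairings on the
  product of circles behave like the differences of three angles, and the integral needs the
  further condition that the exponents have a sum greater than \<open>-2\<close>.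
\<close>

locale orthogonal_complex_structure =
  fixes \<Phi> :: "'a::euclidean_space \<Rightarrow> 'a"
  assumes linear_\<Phi>: "linear \<Phi>"
    and inner_\<Phi>_\<Phi>: "\<Phi> x \<bullet> \<Phi> y = x \<bullet> y"
    and \<Phi>_\<Phi>: "\<Phi> (\<Phi> x) = - x"
    and dim_ge_3: "3 \<le> DIM('a)"
begin

definition \<omega> :: "'a \<Rightarrow> 'a \<Rightarrow> real" where
  "\<omega> x y = x \<bullet> \<Phi> y"

lemma norm_\<Phi>: "norm (\<Phi> x) = norm x"
  by (simp add: norm_eq_sqrt_inner inner_\<Phi>_\<Phi>)

lemma \<omega>_skew: "\<omega> x y = - \<omega> y x"
  unfolding \<omega>_def using inner_\<Phi>_\<Phi>[of x "\<Phi> y"] by (simp add: \<Phi>_\<Phi> inner_commute)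

lemma \<omega>_self: "\<omega> x x = 0"
  using \<omega>_skew[of x x] by simp

lemma \<omega>_\<Phi>_left: "\<omega> (\<Phi> x) y = x \<bullet> y"
  by (simp add: \<omega>_def inner_\<Phi>_\<Phi>)

lemma \<omega>_\<Phi>_right: "\<omega> x (\<Phi> y) = - (x \<bullet> y)"
  by (simp add: \<omega>_def \<Phi>_\<Phi>)

lemma linear_\<omega>_left: "linear (\<lambda>x. \<omega> x y)"
  by (simp add: \<omega>_def linear_iff inner_add_left)

lemma linear_\<omega>_right: "linear (\<omega> x)"
  using linear_\<Phi> by (simp add: \<omega>_def linear_iff inner_add_right)

lemma \<omega>_scaleR: "\<omega> (r *\<^sub>R x) y = r * \<omega> x y" "\<omega> x (r *\<^sub>R y) = r * \<omega> x y"
  using linear_scale[OF linear_\<omega>_left] linear_scale[OF linear_\<omega>_right] by simp_all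

lemma abs_\<omega>_le: "\<bar>\<omega> x y\<bar> \<le> norm x * norm y"
  using Cauchy_Schwarz_ineq2[of x "\<Phi> y"] by (simp add: \<omega>_def norm_\<Phi>)

lemma continuous_on_\<omega> [continuous_intros]:
  assumes "continuous_on S f" "continuous_on S g"
  shows "continuous_on S (\<lambda>v. \<omega> (f v) (g v))"
  unfolding \<omega>_def
  by (intro continuous_intros assms bounded_linear.continuous_on[OF linear_\<Phi>[unfolded linear_conv_bounded_linear]])

lemma borel_measurable_\<omega> [measurable]:
  assumes [measurable]: "f \<in> borel_measurable M" "g \<in> borel_measurable M"
  shows "(\<lambda>v. \<omega> (f v) (g v)) \<in> borel_measurable M"
proof -
  have [measurable]: "\<Phi> \<in> borel_measurable borel"
    by (rule linear_imp_borel_measurable[OF linear_\<Phi>])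
  show ?thesis unfolding \<omega>_def by measurable
qed

definition kernel :: "real \<Rightarrow> real \<Rightarrow> real \<Rightarrow> 'a \<Rightarrow> 'a \<Rightarrow> 'a \<Rightarrow> ennreal" where
  "kernel a b c x y z = ennreal (\<bar>\<omega> y z\<bar> powr a * \<bar>\<omega> z x\<bar> powr b * \<bar>\<omega> x y\<bar> powr c)"

lemma borel_measurable_kernel [measurable]:
  assumes [measurable]: "f \<in> borel_measurable M" "g \<in> borel_measurable M" "h \<in> borel_measurable M"
  shows "(\<lambda>v. kernel a b c (f v) (g v) (h v)) \<in> borel_measurable M"
  unfolding kernel_def by measurable

lemma kernel_rotate: "kernel a b c x y z = kernel b c a y z x"
  by (simp add: kernel_def mult_ac)

definition kernel_integral :: "real \<Rightarrow> real \<Rightarrow> real \<Rightarrow> ennreal" where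
  "kernel_integral a b c = (\<integral>\<^sup>+x. (\<integral>\<^sup>+y. (\<integral>\<^sup>+z. kernel a b c (sgn x) (sgn y) (sgn z)
     \<partial>ball_measure) \<partial>ball_measure) \<partial>ball_measure)"

text \<open>
  The cyclic symmetry of the kernel lets the divergence be studied for the first exponent only.
\<close>

lemma kernel_integral_rotate: "kernel_integral a b c = kernel_integral b c a"
proof -
  let ?k = "\<lambda>x y z. kernel b c a (sgn y) (sgn z) (sgn x)"
  have "kernel_integral a b c = (\<integral>\<^sup>+x. (\<integral>\<^sup>+y. (\<integral>\<^sup>+z. ?k x y z \<partial>ball_measure) \<partial>ball_measure) \<partial>ball_measure)"
    by (simp add: kernel_integral_def kernel_rotate[of a b c])
  also have "\<dots> = (\<integral>\<^sup>+y. (\<integral>\<^sup>+x. (\<integral>\<^sup>+z. ?k x y z \<partial>ball_measure) \<partial>ball_measure) \<partial>ball_measure)"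
    by (rule ball_measure_pair.Fubini') measurable
  also have "\<dots> = (\<integral>\<^sup>+y. (\<integral>\<^sup>+z. (\<integral>\<^sup>+x. ?k x y z \<partial>ball_measure) \<partial>ball_measure) \<partial>ball_measure)"
    by (intro nn_integral_cong ball_measure_pair.Fubini') measurable
  finally show ?thesis by (simp add: kernel_integral_def)
qed

section \<open>Convergence\<close>

lemma kernel_le_singular_power:
  assumes s: "0 \<le> s" "- s \<le> a" "- s \<le> b" "- s \<le> c" and x: "norm x = 1"
    and y: "y \<in> ball 0 1" "y \<noteq> 0" and z: "z \<in> ball 0 1" "z \<noteq> 0"
  shows "kernel a b c x (sgn y) (sgn z)
    \<le> singular_power s (\<omega> y z) * singular_power s (\<omega> z x) * singular_power s (\<omega> x y)"
proof -
  have *: "ennreal (\<bar>\<omega> (sgn u) (sgn v)\<bar> powr e) \<le> singular_power s (\<omega> u v)"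
    if "- s \<le> e" "norm u \<le> 1" "norm v \<le> 1" "u \<noteq> 0" "v \<noteq> 0" for u v e
  proof (rule powr_le_singular_power)
    have "\<omega> (norm u *\<^sub>R sgn u) (norm v *\<^sub>R sgn v) = (norm u * norm v) * \<omega> (sgn u) (sgn v)"
      by (simp only: \<omega>_scaleR mult_ac)
    then have "\<bar>\<omega> u v\<bar> = (norm u * norm v) * \<bar>\<omega> (sgn u) (sgn v)\<bar>"
      using that by (simp add: sgn_div_norm abs_mult)
    also have "\<dots> \<le> 1 * \<bar>\<omega> (sgn u) (sgn v)\<bar>"
      using that by (intro mult_right_mono mult_le_one) auto
    finally show "\<bar>\<omega> u v\<bar> \<le> \<bar>\<omega> (sgn u) (sgn v)\<bar>" by simp
    show "\<bar>\<omega> (sgn u) (sgn v)\<bar> \<le> 1"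
      using abs_\<omega>_le[of "sgn u" "sgn v"] that by (simp add: norm_sgn)
  qed (use s that in auto)
  have "x \<noteq> 0" "sgn x = x" using x by (auto simp: sgn_div_norm)
  with *[of a y z] *[of b z x] *[of c x y] assms show ?thesis
    unfolding kernel_def by (simp add: ennreal_mult mult_mono)
qed

text \<open>
  The integral over \<open>z\<close> and \<open>y\<close> is bounded uniformly in the unit vector \<open>x\<close>. The direction \<open>w\<close>
  chosen below depends on \<open>x\<close> alone, which is what keeps the bound of the inner integral simple enough to be
  integrated over \<open>y\<close>.
\<close>

lemma kernel_integral_finite:
  assumes "a > -1" "b > -1" "c > -1"
  shows "kernel_integral a b c < \<infinity>"
proof -
  define s where "s = max 0 (max (- a) (max (- b) (- c)))"
  have s: "0 \<le> s" "s < 1" "- s \<le> a" "- s \<le> b" "- s \<le> c"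
    using assms by (auto simp: s_def)
  obtain C where C: "C < \<infinity>"
    "\<And>a b. (\<integral>\<^sup>+r\<in>{0..1}. singular_power s (a + r * b) \<partial>lborel) \<le> C * singular_power s b"
    using nn_integral_singular_power_line[OF s(1,2)] by blast
  define B where "B = C\<^sup>2 * emeasure lborel (ball (0::'a) 3)"
  have B: "B < \<infinity>"
    using C(1) emeasure_lborel_ball_finite[of "0::'a" 3]
    by (simp add: B_def ennreal_mult_less_top power2_eq_square)
  have slice: "(\<integral>\<^sup>+y. (\<integral>\<^sup>+z. kernel a b c x (sgn y) (sgn z) \<partial>ball_measure) \<partial>ball_measure) \<le> B * B"
    if x: "norm x = 1" for x
  proof -
    obtain w where w: "norm w = 1" "w \<bullet> x = 0" "w \<bullet> \<Phi> x = 0"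
    proof -
      have "dim {x, \<Phi> x} < DIM('a)"
        using dim_le_card[of "{x, \<Phi> x}" "{x, \<Phi> x}"] dim_ge_3 span_superset[of "{x, \<Phi> x}"]
        by (auto simp: card_insert_if split: if_splits)
      then obtain v where v: "v \<noteq> 0" "\<And>y. y \<in> span {x, \<Phi> x} \<Longrightarrow> orthogonal v y"
        using orthogonal_to_subspace_exists by blast
      then have "v \<bullet> x = 0" "v \<bullet> \<Phi> x = 0"
        by (auto simp: orthogonal_def span_base)
      with v show thesis
        by (intro that[of "sgn v"]) (auto simp: norm_sgn sgn_div_norm)
    qed
    have [simp]: "singular_power s (\<omega> (\<Phi> x) x) = 1" "singular_power s (\<omega> x (\<Phi> x)) = 1"
      "singular_power s (\<omega> (\<Phi> w) w) = 1"
      using x w by (auto intro!: singular_power_unit simp: \<omega>_\<Phi>_left \<omega>_\<Phi>_right simp flip: power2_norm_eq_inner)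
    \<comment> \<open>The form \<open>\<omega> z x\<close> vanishes for \<open>z = w\<close>, and equals \<open>1\<close> for \<open>z = \<Phi> x\<close>.\<close>
    have inner: "(\<integral>\<^sup>+z\<in>ball 0 1. singular_power s (\<omega> y z) * singular_power s (\<omega> z x) \<partial>lborel)
        \<le> B * singular_power s (\<omega> y w)" for y
      using nn_integral_ball_two_singular_linear[OF C(2) linear_\<omega>_right[of y] linear_\<omega>_left[of x], of w "\<Phi> x"]
        x w by (simp add: norm_\<Phi> B_def \<omega>_def[of w x])
    \<comment> \<open>The form \<open>\<omega> x y\<close> vanishes for \<open>y = \<Phi> w\<close> because \<open>w\<close> is orthogonal to \<open>x\<close>, and \<open>\<omega> (\<Phi> w) w = 1\<close>.\<close>
    have outer: "(\<integral>\<^sup>+y\<in>ball 0 1. singular_power s (\<omega> y w) * singular_power s (\<omega> x y) \<partial>lborel) \<le> B"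
      using nn_integral_ball_two_singular_linear[OF C(2) linear_\<omega>_left[of w] linear_\<omega>_right[of x], of "\<Phi> w" "\<Phi> x"]
        x w by (simp add: norm_\<Phi> B_def \<omega>_\<Phi>_right[of x w] inner_commute)
    have "(\<integral>\<^sup>+y. (\<integral>\<^sup>+z. kernel a b c x (sgn y) (sgn z) \<partial>ball_measure) \<partial>ball_measure)
        = (\<integral>\<^sup>+y. (\<integral>\<^sup>+z. kernel a b c x (sgn y) (sgn z) * indicator (ball 0 1 - {0}) z \<partial>lborel)
            * indicator (ball 0 1 - {0}) y \<partial>lborel)"
      by (simp add: nn_integral_ball_measure)
    also have "\<dots> \<le> (\<integral>\<^sup>+y. B * (singular_power s (\<omega> y w) * singular_power s (\<omega> x y) * indicator (ball 0 1) y) \<partial>lborel)"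
    proof (intro nn_integral_mono)
      fix y :: 'a
      show "(\<integral>\<^sup>+z. kernel a b c x (sgn y) (sgn z) * indicator (ball 0 1 - {0}) z \<partial>lborel) * indicator (ball 0 1 - {0}) y
        \<le> B * (singular_power s (\<omega> y w) * singular_power s (\<omega> x y) * indicator (ball 0 1) y)"
      proof (cases "y \<in> ball 0 1 - {0}")
        case True
        have "(\<integral>\<^sup>+z. kernel a b c x (sgn y) (sgn z) * indicator (ball 0 1 - {0}) z \<partial>lborel)
            \<le> (\<integral>\<^sup>+z. singular_power s (\<omega> x y) * (singular_power s (\<omega> y z) * singular_power s (\<omega> z x) * indicator (ball 0 1) z) \<partial>lborel)"
          using True kernel_le_singular_power[OF s(1,3,4,5) x, of y]
          by (intro nn_integral_mono) (auto simp: indicator_def mult_ac)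
        also have "\<dots> = singular_power s (\<omega> x y) *
            (\<integral>\<^sup>+z\<in>ball 0 1. singular_power s (\<omega> y z) * singular_power s (\<omega> z x) \<partial>lborel)"
          by (rule nn_integral_cmult) (measurable, simp)
        also have "\<dots> \<le> singular_power s (\<omega> x y) * (B * singular_power s (\<omega> y w))"
          by (rule mult_left_mono[OF inner]) simp
        finally show ?thesis using True by (simp add: mult_ac)
      qed simp
    qed
    also have "\<dots> = B * (\<integral>\<^sup>+y\<in>ball 0 1. singular_power s (\<omega> y w) * singular_power s (\<omega> x y) \<partial>lborel)"
      by (rule nn_integral_cmult) (measurable, simp)
    also have "\<dots> \<le> B * B"
      by (rule mult_left_mono[OF outer]) simp
    finally show ?thesis .
  qed
  have "kernel_integral a b c \<le> (\<integral>\<^sup>+(x::'a). B * B \<partial>ball_measure)"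
    unfolding kernel_integral_def
  proof (rule nn_integral_mono_AE)
    show "AE x in ball_measure. (\<integral>\<^sup>+y. (\<integral>\<^sup>+z. kernel a b c (sgn x) (sgn y) (sgn z)
        \<partial>ball_measure) \<partial>ball_measure) \<le> B * B"
      using AE_ball_measure by eventually_elim (auto intro!: slice simp: norm_sgn)
  qed
  also have "\<dots> < \<infinity>"
    using B emeasure_punctured_ball_finite[where 'a='a]
    by (simp only: nn_integral_const_ball_measure infinity_ennreal_def ennreal_mult_less_top) simp
  finally show ?thesis .
qed

section \<open>Divergence\<close>

text \<open>
  The point \<open>p = y /\<^sub>R 2\<close> represents the direction \<open>y\<close> inside the ball. There \<open>\<omega> y p = 0\<close>, while the
  remaining factor \<open>\<phi>\<close> of the kernel is continuous and positive because \<open>\<omega> y x \<noteq> 0\<close>.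
\<close>

lemma kernel_slice_divergent:
  assumes "a \<le> -1" and x: "norm x = 1" and y: "norm y = 1" and xy: "\<omega> x y \<noteq> 0"
  shows "(\<integral>\<^sup>+z. kernel a b c x y (sgn z) \<partial>ball_measure) = \<infinity>"
proof -
  define p where "p = y /\<^sub>R 2"
  define \<phi> where "\<phi> = (\<lambda>z. \<bar>\<omega> (sgn z) x\<bar> powr b * \<bar>\<omega> x y\<bar> powr c * norm z powr (- a))"
  have p: "norm p = 1 / 2" "sgn p = y" "\<omega> y p = 0"
    using y by (auto simp: p_def sgn_div_norm \<omega>_scaleR \<omega>_self)
  then have "p \<noteq> 0" by auto
  have yx: "\<omega> y x \<noteq> 0" using xy \<omega>_skew[of x y] by simp
  have "\<phi> p > 0" using p xy yx \<open>p \<noteq> 0\<close> by (simp add: \<phi>_def zero_less_mult_iff)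
  moreover have "isCont \<phi> p"
  proof -
    have "isCont (\<lambda>z. \<omega> z x) q" for q
      using linear_\<omega>_left[of x] by (simp add: linear_continuous_at linear_conv_bounded_linear)
    then have "isCont (\<lambda>z. \<omega> (sgn z) x) p"
      using isCont_o2[OF isCont_sgn[OF continuous_ident \<open>p \<noteq> 0\<close>]] by blast
    then show ?thesis
      unfolding \<phi>_def using p yx \<open>p \<noteq> 0\<close> by (intro continuous_intros) auto
  qed
  ultimately obtain d where d: "d > 0" "\<And>z. dist z p < d \<Longrightarrow> dist (\<phi> z) (\<phi> p) < \<phi> p / 2"
    unfolding continuous_at_eps_delta by (metis half_gt_zero)
  define \<epsilon> where "\<epsilon> = min d (1 / 2)"
  have \<epsilon>: "\<epsilon> > 0" using d by (simp add: \<epsilon>_def)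
  have near: "z \<in> ball 0 1 - {0}" "\<phi> p / 2 \<le> \<phi> z" if "z \<in> ball p \<epsilon>" for z
  proof -
    show "z \<in> ball 0 1 - {0}"
      using that p norm_triangle_ineq2[of z p] norm_triangle_ineq2[of p z]
      by (auto simp: \<epsilon>_def dist_norm norm_minus_commute)
    have "\<bar>\<phi> z - \<phi> p\<bar> < \<phi> p / 2"
      using that d(2)[of z] by (simp add: \<epsilon>_def dist_real_def dist_commute)
    then show "\<phi> p / 2 \<le> \<phi> z"
      by (simp only: abs_diff_less_iff) argo
  qed
  have kernel: "kernel a b c x y (sgn z) = ennreal (\<phi> z) * ennreal (\<bar>\<omega> y z\<bar> powr a)" if "z \<noteq> 0" for z
  proof -
    have "\<bar>\<omega> y (sgn z)\<bar> powr a = norm z powr (- a) * \<bar>\<omega> y z\<bar> powr a"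
      using that by (simp add: sgn_div_norm \<omega>_scaleR abs_mult powr_mult powr_minus inverse_powr)
    then show ?thesis
      by (simp add: kernel_def \<phi>_def mult_ac flip: ennreal_mult)
  qed
  have "\<infinity> = ennreal (\<phi> p / 2) * (\<integral>\<^sup>+z\<in>ball p \<epsilon>. ennreal (\<bar>\<omega> y z\<bar> powr a) \<partial>lborel)"
    using nn_integral_ball_powr_linear_divergent[OF linear_\<omega>_right[of y], of "\<Phi> y" p \<epsilon> a] p \<epsilon> y \<open>\<phi> p > 0\<close> assms(1)
    by (auto simp: \<omega>_\<Phi>_right ennreal_mult_top simp flip: power2_norm_eq_inner)
  also have "\<dots> = (\<integral>\<^sup>+z. ennreal (\<phi> p / 2) * (ennreal (\<bar>\<omega> y z\<bar> powr a) * indicator (ball p \<epsilon>) z) \<partial>lborel)"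
    by (rule nn_integral_cmult[symmetric]) (measurable, simp)
  also have "\<dots> \<le> (\<integral>\<^sup>+z. kernel a b c x y (sgn z) * indicator (ball 0 1 - {0}) z \<partial>lborel)"
  proof (intro nn_integral_mono)
    fix z :: 'a
    show "ennreal (\<phi> p / 2) * (ennreal (\<bar>\<omega> y z\<bar> powr a) * indicator (ball p \<epsilon>) z)
        \<le> kernel a b c x y (sgn z) * indicator (ball 0 1 - {0}) z"
      using near[of z] by (cases "z \<in> ball p \<epsilon>") (auto simp: kernel intro!: mult_right_mono ennreal_leI)
  qed
  finally show ?thesis
    by (simp add: nn_integral_ball_measure top_unique)
qed

text \<open>
  For a unit vector \<open>x\<close> the set of those \<open>y\<close> in the ball with \<open>\<omega> x y \<noteq> 0\<close> is open and contains
  \<open>\<Phi> x /\<^sub>R 2\<close>, so it is not a null set, and the inner integral is infinite on it.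
\<close>

lemma kernel_integral_infinite:
  assumes "a \<le> -1"
  shows "kernel_integral a b c = \<infinity>"
proof -
  have slice: "(\<integral>\<^sup>+y. (\<integral>\<^sup>+z. kernel a b c x (sgn y) (sgn z) \<partial>ball_measure) \<partial>ball_measure) = \<infinity>"
    if x: "norm x = 1" for x
  proof -
    define U where "U = ball 0 1 \<inter> {y. \<omega> x y \<noteq> 0}"
    have "open U"
      unfolding U_def by (intro open_Int open_Collect_neq continuous_intros) auto
    moreover have "\<Phi> x /\<^sub>R 2 \<in> U"
      using x by (auto simp: U_def norm_\<Phi> \<omega>_scaleR \<omega>_\<Phi>_right)
    ultimately have U: "U \<in> sets borel" "emeasure lborel U \<noteq> 0"
      using emeasure_lborel_open_nonzero[of U] by auto
    then have "\<infinity> = (\<integral>\<^sup>+y\<in>U. \<infinity> \<partial>lborel)"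
      by (subst nn_integral_cmult_indicator) (auto simp: ennreal_top_mult)
    also have "\<dots> \<le> (\<integral>\<^sup>+y\<in>ball 0 1 - {0}. (\<integral>\<^sup>+z. kernel a b c x (sgn y) (sgn z) \<partial>ball_measure) \<partial>lborel)"
    proof (intro nn_integral_mono)
      fix y :: 'a
      have "y \<in> ball 0 1 - {0}" "(\<integral>\<^sup>+z. kernel a b c x (sgn y) (sgn z) \<partial>ball_measure) = \<infinity>" if "y \<in> U"
      proof -
        show y: "y \<in> ball 0 1 - {0}"
          using that linear_0[OF linear_\<omega>_right[of x]] by (auto simp: U_def)
        show "(\<integral>\<^sup>+z. kernel a b c x (sgn y) (sgn z) \<partial>ball_measure) = \<infinity>"
          using y that assms x
          by (intro kernel_slice_divergent) (auto simp: U_def norm_sgn sgn_div_norm \<omega>_scaleR)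
      qed
      then show "\<infinity> * indicator U y
          \<le> (\<integral>\<^sup>+z. kernel a b c x (sgn y) (sgn z) \<partial>ball_measure) * indicator (ball 0 1 - {0}) y"
        by (auto simp: indicator_def)
    qed
    also have "\<dots> = (\<integral>\<^sup>+y. (\<integral>\<^sup>+z. kernel a b c x (sgn y) (sgn z) \<partial>ball_measure) \<partial>ball_measure)"
      by (rule nn_integral_ball_measure[symmetric]) measurable
    finally show ?thesis by (simp add: top_unique)
  qed
  have "kernel_integral a b c = (\<integral>\<^sup>+(x::'a). \<infinity> \<partial>ball_measure)"
    unfolding kernel_integral_def
  proof (rule nn_integral_cong_AE)
    show "AE x in ball_measure. (\<integral>\<^sup>+y. (\<integral>\<^sup>+z. kernel a b c (sgn x) (sgn y) (sgn z)
        \<partial>ball_measure) \<partial>ball_measure) = \<infinity>"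
      using AE_ball_measure by eventually_elim (rule slice, auto simp: norm_sgn)
  qed
  also have "\<dots> = \<infinity>"
  proof -
    have "ball 0 1 - {0::'a} \<noteq> {}"
    proof -
      obtain b :: 'a where "norm b = 1 / 2" using vector_choose_size[of "1 / 2"] by auto
      then have "b \<in> ball 0 1 - {0}" by auto
      then show ?thesis by blast
    qed
    then have "emeasure lborel (ball 0 1 - {0::'a}) \<noteq> 0"
      by (intro emeasure_lborel_open_nonzero) auto
    then show ?thesis
      by (simp only: nn_integral_const_ball_measure infinity_ennreal_def ennreal_top_mult) simp
  qed
  finally show ?thesis .
qed

lemma kernel_integral_finite_iff:
  "kernel_integral a b c < \<infinity> \<longleftrightarrow> a > -1 \<and> b > -1 \<and> c > -1"
proof
  assume fin: "kernel_integral a b c < \<infinity>"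
  then have "kernel_integral b c a < \<infinity>" "kernel_integral c a b < \<infinity>"
    using kernel_integral_rotate[of a b c] kernel_integral_rotate[of b c a] by simp_all
  with fin show "a > -1 \<and> b > -1 \<and> c > -1"
    using kernel_integral_infinite[of a b c] kernel_integral_infinite[of b c a]
      kernel_integral_infinite[of c a b] by (auto simp: not_le[symmetric])
qed (blast intro: kernel_integral_finite)

end

section \<open>The matrix \<open>\<Phi>\<close> and the kernel on the spheres\<close>

lemma sum_UNIV_sum:
  fixes f :: "'a::finite + 'b::finite \<Rightarrow> 'c::comm_monoid_add"
  shows "(\<Sum>i\<in>UNIV. f i) = (\<Sum>a\<in>UNIV. f (Inl a)) + (\<Sum>b\<in>UNIV. f (Inr b))"
  by (subst UNIV_Plus_UNIV[symmetric], subst sum.Plus) (simp_all add: sum.reindex)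

lemma block_matrix_mult_vec:
  "(block_matrix A B C D *v x) $ Inl a = (\<Sum>c\<in>UNIV. A $ a $ c * x $ Inl c) + (\<Sum>d\<in>UNIV. B $ a $ d * x $ Inr d)"
  "(block_matrix A B C D *v x) $ Inr b = (\<Sum>c\<in>UNIV. C $ b $ c * x $ Inl c) + (\<Sum>d\<in>UNIV. D $ b $ d * x $ Inr d)"
  by (simp_all add: matrix_vector_mult_def block_matrix_def sum_UNIV_sum)

lemma sum_mat_1: "(\<Sum>d\<in>UNIV. mat 1 $ k $ d * f d) = (f k :: real)"
  by (simp add: mat_def if_distrib[of "\<lambda>t. t * _"] cong: if_cong)

lemma J_matrix_nth:
  "(\<Sum>d\<in>UNIV. J_matrix $ Inl k $ d * f d) = - (f (Inr k) :: real)"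
  "(\<Sum>d\<in>UNIV. J_matrix $ Inr k $ d * f d) = f (Inl k)"
  by (simp_all add: J_matrix_def block_matrix_def sum_UNIV_sum sum_mat_1 sum_negf)

lemma Phi_matrix_mult_vec:
  "(Phi_matrix *v x) $ Inl (Inl k) = - x $ Inl (Inr k)"
  "(Phi_matrix *v x) $ Inl (Inr k) = x $ Inl (Inl k)"
  "(Phi_matrix *v x) $ Inr (Inl k) = x $ Inr (Inr k)"
  "(Phi_matrix *v x) $ Inr (Inr k) = - x $ Inr (Inl k)"
  by (simp_all add: Phi_matrix_def block_matrix_mult_vec J_matrix_nth sum_negf)

interpretation Phi: orthogonal_complex_structure
  "\<lambda>x :: real^(('n::finite + 'n) + ('n + 'n)). Phi_matrix *v x"
proof (rule orthogonal_complex_structure.intro, goal_cases)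
  case 1
  show ?case by (rule matrix_vector_mul_linear)
next
  case (2 x y)
  show ?case by (simp add: inner_vec_def sum_UNIV_sum Phi_matrix_mult_vec)
next
  case (3 x)
  have "(Phi_matrix *v (Phi_matrix *v x)) $ i = (- x) $ i" for i
    by (cases i rule: sum.exhaust; rename_tac j; case_tac j) (simp_all add: Phi_matrix_mult_vec)
  then show ?case by (simp add: vec_eq_iff)
next
  case 4
  have "0 < CARD('n::finite)" by simp
  then have "3 \<le> CARD('n) + CARD('n) + (CARD('n) + CARD('n))" by linarith
  then show ?case by simp
qed

lemma norm_h_kernel:
  "ennreal (norm (h_kernel lam X Y Z)) = Phi.kernel (Re (lam $ 1)) (Re (lam $ 2)) (Re (lam $ 3)) X Y Z"
  by (simp add: h_kernel_def Phi.kernel_def Phi.\<omega>_def norm_mult norm_powr_real_powr)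

text \<open>
  Away from \<open>t = 0\<close> only the real logarithm is involved, so the branch cut of the complex one does
  not enter.
\<close>

lemma borel_measurable_abs_powr_complex [measurable]:
  fixes s :: complex
  assumes [measurable]: "f \<in> borel_measurable M"
  shows "(\<lambda>v. complex_of_real \<bar>f v\<bar> powr s) \<in> borel_measurable M"
proof -
  have "complex_of_real \<bar>t\<bar> powr s = (if t = 0 then 0 else exp (s * complex_of_real (ln \<bar>t\<bar>)))" for t
    by (simp add: powr_def Ln_of_real)
  then show ?thesis by simp
qed

lemma borel_measurable_h_kernel:
  "(\<lambda>(X, Y, Z). h_kernel lam X Y Z) \<in> borel_measurable (borel \<Otimes>\<^sub>M (borel \<Otimes>\<^sub>M borel))"
  unfolding h_kernel_def Phi.\<omega>_def[symmetric] by measurable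

theorem proposition4p1:
  fixes lam :: "complex^3"
  shows "integrable (sphere_measure \<Otimes>\<^sub>M (sphere_measure \<Otimes>\<^sub>M sphere_measure))
           (\<lambda>(X :: real^(('n::finite + 'n) + ('n + 'n)), Y, Z). h_kernel lam X Y Z)
         \<longleftrightarrow> (\<forall>j. Re (lam $ j) > -1)"
proof -
  let ?S = "sphere_measure :: (real^(('n + 'n) + ('n + 'n))) measure"
  let ?h = "\<lambda>(X :: real^(('n + 'n) + ('n + 'n)), Y, Z). h_kernel lam X Y Z"
  let ?D = "of_nat DIM(real^(('n + 'n) + ('n + 'n))) :: ennreal"
  let ?K = "Phi.kernel_integral TYPE('n) (Re (lam $ 1)) (Re (lam $ 2)) (Re (lam $ 3))"
  note [measurable] = borel_measurable_h_kernel
  have "(\<integral>\<^sup>+p. ennreal (norm (?h p)) \<partial>(?S \<Otimes>\<^sub>M (?S \<Otimes>\<^sub>M ?S))) = ?D ^ 3 * ?K"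
    by (subst nn_integral_triple_sphere_measure) (simp_all add: norm_h_kernel Phi.kernel_integral_def)
  moreover have "?D ^ 3 * k < \<infinity> \<longleftrightarrow> k < \<infinity>" for k
  proof -
    have "?D ^ 3 < \<infinity>" by (simp only: infinity_ennreal_def power_less_top_ennreal of_nat_less_top) simp
    then show ?thesis by (auto simp: ennreal_mult_less_top)
  qed
  moreover have "?h \<in> borel_measurable (?S \<Otimes>\<^sub>M (?S \<Otimes>\<^sub>M ?S))"
    by (rule measurable_triple_sphere_measure[OF borel_measurable_h_kernel])
  ultimately have "integrable (?S \<Otimes>\<^sub>M (?S \<Otimes>\<^sub>M ?S)) ?h \<longleftrightarrow> ?K < \<infinity>"
    by (simp only: integrable_iff_bounded simp_thms)
  also have "\<dots> \<longleftrightarrow> (\<forall>j. Re (lam $ j) > -1)"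
    by (simp only: Phi.kernel_integral_finite_iff forall_3)
  finally show ?thesis .
qed

end
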